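(* For any Hausdorff space $X$, $|X|\leq\pi\chi(X)^{c(X)\cdot nq(X)\cdot w\psi_c(X)}$.
   Context: Cardinal functions follow Juhász's conventions; in particular $\pi\chi(X)$ and $c(X)$ are by convention infinite cardinals. A local $\pi$-base at $x\in X$ is a family $\mathcal{B}$ of nonempty open subsets of $X$ such that every open set containing $x$ contains a member of $\mathcal{B}$. The $\pi$-character $\pi\chi(X)$ is the least infinite cardinal $\lambda$ such that every $x\in X$ has a local $\pi$-base of cardinality at most $\lambda$. The cellularity $c(X)$ is the least infinite cardinal $\kappa$ such that every family of pairwise disjoint nonempty open subsets of $X$ has cardinality at most $\kappa$. The nonquasiregularity degree $nq(X)$ is the least infinite cardinal $\kappa$ such that for every nonempty open set $U\subseteq X$ there is a family $\mathcal{V}$ of open subsets of $X$ with $|\mathcal{V}|\leq\kappa$, such that $G=\bigcap\mathcal{V}$ is a nonempty subset of $U$ and $\bigcap_{V\in\mathcal{V}}\overline{V}\subseteq U$. Such a $\kappa$ exists whenever $X$ is Hausdorff. For a Hausdorff space $X$ and $x\in X$, a collection $\mathcal{V}$ of open subsets of $X$ is a weak closed pseudobase at $x$ if $\{x\}=\bigcap_{V\in\mathcal{V}}\overline{V}$ (it is not required that $x\in V$ for any $V\in\mathcal{V}$). The cardinal $w\psi_c(x,X)$ is the least infinite cardinal $\kappa$ such that $x$ has a weak closed pseudobase of cardinality at most $\kappa$. The weak closed pseudocharacter is $w\psi_c(X)=\sup\{w\psi_c(x,X):x\in X\}$ (taken to be $\aleph_0$ if $X$ is empty). *)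

theory Defs
  imports "HOL-Analysis.T1_Spaces"
begin

unbundle cardinal_syntax

text \<open>
  HOL has no global class of cardinals, so the invariants of a space on type 'a take their values
  among the \<^const>\<open>Card_order\<close> relations on the following type. It is infinite and contains a copy
  of every collection of subsets of a space on 'a, hence every cardinal that can occur
  as a value has a representative there (see \<open>ex_representative\<close> and the \<open>_spec\<close> lemmas).
\<close>

type_synonym 'a cardinal = "('a set + nat) rel"

text \<open>Representatives are unique only up to \<open>=o\<close>, hence the choice operator.\<close>

definition is_least_infinite_card :: "('b rel \<Rightarrow> bool) \<Rightarrow> 'b rel \<Rightarrow> bool" where
  "is_least_infinite_card P \<kappa> \<longleftrightarrow>
     Cinfinite \<kappa> \<and> P \<kappa> \<and> (\<forall>\<mu>. Cinfinite \<mu> \<and> P \<mu> \<longrightarrow> \<kappa> \<le>o \<mu>)"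

definition least_infinite_card :: "('b rel \<Rightarrow> bool) \<Rightarrow> 'b rel" where
  "least_infinite_card P = (SOME \<kappa>. is_least_infinite_card P \<kappa>)"

definition local_pi_base :: "'a topology \<Rightarrow> 'a \<Rightarrow> 'a set set \<Rightarrow> bool" where
  "local_pi_base X x \<B> \<longleftrightarrow>
     (\<forall>B\<in>\<B>. openin X B \<and> B \<noteq> {}) \<and>
     (\<forall>U. openin X U \<and> x \<in> U \<longrightarrow> (\<exists>B\<in>\<B>. B \<subseteq> U))"

definition pi_character :: "'a topology \<Rightarrow> 'a cardinal" where
  "pi_character X = least_infinite_card (\<lambda>\<kappa>.
     \<forall>x\<in>topspace X. \<exists>\<B>. local_pi_base X x \<B> \<and> |\<B>| \<le>o \<kappa>)"

definition cellularity :: "'a topology \<Rightarrow> 'a cardinal" where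
  "cellularity X = least_infinite_card (\<lambda>\<kappa>.
     \<forall>\<U>. (\<forall>U\<in>\<U>. openin X U \<and> U \<noteq> {}) \<and> pairwise disjnt \<U> \<longrightarrow> |\<U>| \<le>o \<kappa>)"

text \<open>
  Below, intersections of families of subsets of the space are taken relative to the space, so that
  the empty family has intersection \<^term>\<open>topspace X\<close> and not \<^const>\<open>UNIV\<close>.
\<close>

definition nonquasiregularity_degree :: "'a topology \<Rightarrow> 'a cardinal" where
  "nonquasiregularity_degree X = least_infinite_card (\<lambda>\<kappa>.
     \<forall>U. openin X U \<and> U \<noteq> {} \<longrightarrow>
       (\<exists>\<V>. (\<forall>V\<in>\<V>. openin X V) \<and> |\<V>| \<le>o \<kappa> \<and>
            topspace X \<inter> \<Inter>\<V> \<noteq> {} \<and> topspace X \<inter> \<Inter>\<V> \<subseteq> U \<and>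
            topspace X \<inter> (\<Inter>V\<in>\<V>. X closure_of V) \<subseteq> U))"

definition weak_closed_pseudobase :: "'a topology \<Rightarrow> 'a \<Rightarrow> 'a set set \<Rightarrow> bool" where
  "weak_closed_pseudobase X x \<V> \<longleftrightarrow>
     (\<forall>V\<in>\<V>. openin X V) \<and> {x} = topspace X \<inter> (\<Inter>V\<in>\<V>. X closure_of V)"

definition weak_closed_pseudocharacter_at :: "'a topology \<Rightarrow> 'a \<Rightarrow> 'a cardinal" where
  "weak_closed_pseudocharacter_at X x = least_infinite_card (\<lambda>\<kappa>.
     \<exists>\<V>. weak_closed_pseudobase X x \<V> \<and> |\<V>| \<le>o \<kappa>)"

text \<open>
  The supremum of the infinite cardinals at the points, as a least upper bound; the supremum of
  the empty family is the least infinite cardinal.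
\<close>

definition weak_closed_pseudocharacter :: "'a topology \<Rightarrow> 'a cardinal" where
  "weak_closed_pseudocharacter X = least_infinite_card (\<lambda>\<kappa>.
     \<forall>x\<in>topspace X. weak_closed_pseudocharacter_at X x \<le>o \<kappa>)"

lemma is_least_infinite_card:
  assumes "Cinfinite \<kappa>" "P \<kappa>"
  shows "is_least_infinite_card P (least_infinite_card P)"
proof -
  have "\<exists>\<kappa>. is_least_infinite_card P \<kappa>"
  proof -
    obtain \<mu> where \<mu>: "\<mu> \<in> {\<mu>. Cinfinite \<mu> \<and> P \<mu>}"
      and min: "\<And>\<nu>. (\<nu>, \<mu>) \<in> ordLess \<Longrightarrow> \<nu> \<notin> {\<mu>. Cinfinite \<mu> \<and> P \<mu>}"
      using wfE_min[OF wf_ordLess, of \<kappa> "{\<mu>. Cinfinite \<mu> \<and> P \<mu>}"] assms by blast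
    have "\<mu> \<le>o \<nu>" if "Cinfinite \<nu>" "P \<nu>" for \<nu>
      proof -
      have "\<not> \<nu> <o \<mu>"
        using that min[of \<nu>] by blast
      then show ?thesis
        using that(1) \<mu> by (simp add: not_ordLess_iff_ordLeq card_order_on_well_order_on)
    qed
    with \<mu> show ?thesis
      unfolding is_least_infinite_card_def by blast
  qed
  then show ?thesis
    unfolding least_infinite_card_def by (rule someI_ex)
qed

lemma ex_representative:
  fixes \<mu> :: "'c rel"
  assumes "Cinfinite \<mu>" "\<mu> \<le>o |UNIV :: 'b set|"
  shows "\<exists>\<kappa> :: 'b rel. Cinfinite \<kappa> \<and> \<kappa> =o \<mu>"
proof -
  have fld: "|Field \<mu>| =o \<mu>"
    using assms(1) by (simp add: card_of_Field_ordIso)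
  then have "|Field \<mu>| \<le>o |UNIV :: 'b set|"
    using assms(2) ordIso_ordLeq_trans by blast
  then obtain f :: "'c \<Rightarrow> 'b" where f: "inj_on f (Field \<mu>)"
    using card_of_ordLeq[of "Field \<mu>" "UNIV :: 'b set"] by auto
  then have "|Field \<mu>| =o |f ` Field \<mu>|"
    using card_of_ordIsoI inj_on_imp_bij_betw by blast
  then have "|f ` Field \<mu>| =o \<mu>"
    using fld ordIso_symmetric ordIso_transitive by blast
  moreover have "Cinfinite |f ` Field \<mu>|"
    using assms(1) f card_of_Card_order[of "f ` Field \<mu>"]
    by (simp add: cinfinite_def Field_card_of finite_image_iff)
  ultimately show ?thesis
    by blast
qed

lemma Cinfinite_top_cardinal: "Cinfinite |UNIV :: ('a set + nat) set|"
  using card_of_Card_order[of "UNIV :: ('a set + nat) set"]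
  by (simp add: cinfinite_def Field_card_of finite_Plus_UNIV_iff)

lemma card_of_le_top_cardinal: "|\<B> :: 'a set set| \<le>o |UNIV :: ('a set + nat) set|"
  using card_of_ordLeq[of \<B> "UNIV :: ('a set + nat) set"] inj_on_subset[OF inj_Inl] by blast

lemma pi_character_spec:
  "is_least_infinite_card (\<lambda>\<kappa>. \<forall>x\<in>topspace X. \<exists>\<B>. local_pi_base X x \<B> \<and> |\<B>| \<le>o \<kappa>)
     (pi_character X)"
  unfolding pi_character_def
proof (rule is_least_infinite_card[OF Cinfinite_top_cardinal], intro ballI exI conjI)
  show "local_pi_base X x {U. openin X U \<and> U \<noteq> {}}" for x
    by (auto simp: local_pi_base_def)
qed (rule card_of_le_top_cardinal)

lemma cellularity_spec:
  "is_least_infinite_card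
     (\<lambda>\<kappa>. \<forall>\<U>. (\<forall>U\<in>\<U>. openin X U \<and> U \<noteq> {}) \<and> pairwise disjnt \<U> \<longrightarrow> |\<U>| \<le>o \<kappa>)
     (cellularity X)"
  unfolding cellularity_def
  by (rule is_least_infinite_card[OF Cinfinite_top_cardinal]) (simp add: card_of_le_top_cardinal)

lemma weak_closed_pseudobase_nhds:
  assumes "Hausdorff_space X" "x \<in> topspace X"
  shows "weak_closed_pseudobase X x {V. openin X V \<and> x \<in> V}"
proof -
  have "y = x" if "y \<in> topspace X" and y: "\<forall>V. openin X V \<and> x \<in> V \<longrightarrow> y \<in> X closure_of V" for y
  proof (rule ccontr)
    assume "y \<noteq> x"
    then obtain U V where "openin X U" "openin X V" "x \<in> U" "y \<in> V" "disjnt U V"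
      using assms \<open>y \<in> topspace X\<close> unfolding Hausdorff_space_def by metis
    then show False
      using y unfolding in_closure_of disjnt_def by blast
  qed
  moreover have "x \<in> X closure_of V" if "x \<in> V" for V
    using that assms(2) unfolding in_closure_of by blast
  ultimately show ?thesis
    using assms(2) unfolding weak_closed_pseudobase_def by blast
qed

lemma nonquasiregularity_degree_spec:
  assumes "Hausdorff_space X"
  shows "is_least_infinite_card (\<lambda>\<kappa>. \<forall>U. openin X U \<and> U \<noteq> {} \<longrightarrow>
       (\<exists>\<V>. (\<forall>V\<in>\<V>. openin X V) \<and> |\<V>| \<le>o \<kappa> \<and>
            topspace X \<inter> \<Inter>\<V> \<noteq> {} \<and> topspace X \<inter> \<Inter>\<V> \<subseteq> U \<and>
            topspace X \<inter> (\<Inter>V\<in>\<V>. X closure_of V) \<subseteq> U))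
     (nonquasiregularity_degree X)"
  unfolding nonquasiregularity_degree_def
proof (rule is_least_infinite_card[OF Cinfinite_top_cardinal], intro allI impI)
  fix U assume U: "openin X U \<and> U \<noteq> {}"
  then obtain x where x: "x \<in> U" "x \<in> topspace X"
    using openin_subset by blast
  let ?\<V> = "{V. openin X V \<and> x \<in> V}"
  have eq: "{x} = topspace X \<inter> (\<Inter>V\<in>?\<V>. X closure_of V)"
    using weak_closed_pseudobase_nhds[OF assms x(2)] unfolding weak_closed_pseudobase_def by blast
  have "topspace X \<inter> \<Inter>?\<V> \<noteq> {}" "topspace X \<inter> \<Inter>?\<V> \<subseteq> U"
    using x U by blast+
  moreover have "topspace X \<inter> (\<Inter>V\<in>?\<V>. X closure_of V) \<subseteq> U"
    using eq x(1) by auto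
  ultimately show "\<exists>\<V>. (\<forall>V\<in>\<V>. openin X V) \<and> |\<V>| \<le>o |UNIV :: ('a set + nat) set| \<and>
      topspace X \<inter> \<Inter>\<V> \<noteq> {} \<and> topspace X \<inter> \<Inter>\<V> \<subseteq> U \<and>
      topspace X \<inter> (\<Inter>V\<in>\<V>. X closure_of V) \<subseteq> U"
    by (intro exI[of _ ?\<V>] conjI card_of_le_top_cardinal) auto
qed

lemma weak_closed_pseudocharacter_at_spec:
  assumes "Hausdorff_space X" "x \<in> topspace X"
  shows "is_least_infinite_card (\<lambda>\<kappa>. \<exists>\<V>. weak_closed_pseudobase X x \<V> \<and> |\<V>| \<le>o \<kappa>)
     (weak_closed_pseudocharacter_at X x)"
  unfolding weak_closed_pseudocharacter_at_def
  by (rule is_least_infinite_card[OF Cinfinite_top_cardinal])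
    (use weak_closed_pseudobase_nhds[OF assms] card_of_le_top_cardinal in blast)

lemma weak_closed_pseudocharacter_spec:
  assumes "Hausdorff_space X"
  shows "is_least_infinite_card
     (\<lambda>\<kappa>. \<forall>x\<in>topspace X. weak_closed_pseudocharacter_at X x \<le>o \<kappa>)
     (weak_closed_pseudocharacter X)"
  unfolding weak_closed_pseudocharacter_def
proof (rule is_least_infinite_card[OF Cinfinite_top_cardinal], intro ballI)
  fix x assume "x \<in> topspace X"
  then have "Card_order (weak_closed_pseudocharacter_at X x)"
    using weak_closed_pseudocharacter_at_spec[OF assms] unfolding is_least_infinite_card_def
    by blast
  then show "weak_closed_pseudocharacter_at X x \<le>o |UNIV :: ('a set + nat) set|"
    using card_of_Field_ordIso card_of_mono1[OF subset_UNIV] ordIso_symmetric ordIso_ordLeq_trans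
    by blast
qed

end

theory Submission
  imports Defs
begin

text \<open>
  Put \<open>\<kappa> = c(X) \<cdot> nq(X) \<cdot> w\<psi>\<^sub>c(X)\<close> and \<open>\<mu> = \<pi>\<chi>(X)\<^sup>\<kappa>\<close>, so that \<open>\<mu>\<^sup>\<kappa> = \<mu>\<close>.  Closing off under the choice
  of points outside unions \<open>\<Union>i<\<kappa>. cl (\<Union>W\<^sub>i)\<close>, where each \<open>W\<^sub>i\<close> consists of at most \<open>\<kappa>\<close> members of
  local \<open>\<pi>\<close>-bases at points already chosen, gives a set \<open>D\<close> with at most \<open>\<mu>\<close> points.  If \<open>D\<close> were not
  dense, take the family \<open>\<V>\<close> witnessing \<open>nq(X) \<le> \<kappa>\<close> for the complement of its closure, and for each
  \<open>V \<in> \<V>\<close> a maximal disjoint family \<open>W\<^sub>V\<close> of members of the local \<open>\<pi>\<close>-bases missing \<open>V\<close>: the sets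
  \<open>cl (\<Union>W\<^sub>V)\<close> cover \<open>D\<close> but miss \<open>\<Inter>\<V>\<close>, against the closing-off.  Hence \<open>X\<close> has a \<open>\<pi>\<close>-base of
  size at most \<open>\<mu>\<close>.  The closure of an open set is determined by a disjoint subfamily of this
  \<open>\<pi>\<close>-base, so there are at most \<open>\<mu>\<^sup>\<kappa> = \<mu>\<close> of them, and each point is the intersection of at most
  \<open>\<kappa>\<close> of them.
\<close>

section \<open>Closing off\<close>

lemmas card_of_subset_ordLeq = ordLeq_transitive[OF card_of_mono1]

lemmas card_of_image_ordLeq = ordLeq_transitive[OF card_of_image]

text \<open>A nonempty subset of size at most \<open>\<kappa>\<close> is the image of a function
  from \<open>Field \<kappa>\<close> to \<open>S\<close>, so there are at most
  \<open>|S| ^c \<kappa>\<close> of them. The empty set need not be such an image and is added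
  separately.\<close>

lemma card_of_small_subsets:
  fixes S :: "'a set"
  assumes "Cinfinite \<mu>" "Card_order \<kappa>" "\<mu> ^c \<kappa> \<le>o \<mu>" "|S| \<le>o \<mu>"
  shows "|{A. A \<subseteq> S \<and> |A| \<le>o \<kappa>}| \<le>o \<mu>"
proof -
  let ?N = "{A. A \<subseteq> S \<and> |A| \<le>o \<kappa> \<and> A \<noteq> {}}"
  have "A \<in> (\<lambda>g. g ` Field \<kappa>) ` Func (Field \<kappa>) S" if A: "A \<in> ?N" for A
  proof -
    have "|A| \<le>o |Field \<kappa>|"
      using A ordLeq_ordIso_trans[OF _ ordIso_symmetric[OF card_of_Field_ordIso[OF assms(2)]]]
      by blast
    then obtain g where g: "g ` Field \<kappa> = A"
      using A card_of_ordLeq2[of A "Field \<kappa>"] by blast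
    define h where "h = (\<lambda>i. if i \<in> Field \<kappa> then g i else undefined)"
    have "h ` Field \<kappa> = A" using g by (auto simp: h_def)
    moreover have "h \<in> Func (Field \<kappa>) S"
      using A g by (auto simp: h_def Func_def)
    ultimately show ?thesis by blast
  qed
  then have "|?N| \<le>o |Func (Field \<kappa>) S|"
    by (intro surj_imp_ordLeq[of _ "\<lambda>g. g ` Field \<kappa>"]) blast
  also have "|Func (Field \<kappa>) S| = |S| ^c \<kappa>"
    by (simp add: cexp_def Field_card_of)
  also have "|S| ^c \<kappa> \<le>o \<mu> ^c \<kappa>"
    using assms(2,4) by (rule cexp_mono1[rotated])
  also note assms(3)
  finally have N: "|?N| \<le>o \<mu>" .
  have "|{{}} :: 'a set set| \<le>o \<mu>"
    using assms(1) by (intro Card_order_singl_ordLeq) (auto simp: cinfinite_def)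
  with N have "|?N \<union> {{}}| \<le>o \<mu>"
    using assms(1) by (intro card_of_Un_ordLeq_infinite_Field) (auto simp: cinfinite_def)
  moreover have "{A. A \<subseteq> S \<and> |A| \<le>o \<kappa>} \<subseteq> ?N \<union> {{}}" by blast
  ultimately show ?thesis
    by (rule card_of_subset_ordLeq[rotated])
qed

text \<open>\<open>D\<close> is the union of a chain indexed by the successor cardinal of
  \<open>\<kappa>\<close>. That cardinal is regular, so a subset of \<open>D\<close> of size at most
  \<open>\<kappa>\<close> already lies in one stage, and a later stage contains its value under
  \<open>F\<close>.\<close>

lemma ex_small_closed_set:
  fixes F :: "'a set \<Rightarrow> 'a set" and \<kappa> :: "'k rel" and \<mu> :: "'m rel"
  assumes \<kappa>: "Cinfinite \<kappa>" and \<mu>: "Cinfinite \<mu>" and exp: "\<mu> ^c \<kappa> \<le>o \<mu>"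
    and F: "\<And>A. |A| \<le>o \<kappa> \<Longrightarrow> |F A| \<le>o \<mu>"
  shows "\<exists>D. |D| \<le>o \<mu> \<and> (\<forall>A. A \<subseteq> D \<and> |A| \<le>o \<kappa> \<longrightarrow> F A \<subseteq> D)"
proof -
  let ?s = "cardSuc \<kappa>"
  have inf\<mu>: "\<not> finite (Field \<mu>)" and inf_s: "\<not> finite (Field ?s)"
    using \<mu> Cinfinite_cardSuc[OF \<kappa>] by (auto simp: cinfinite_def)
  have co_s: "Card_order ?s" using \<kappa> cardSuc_Card_order by blast
  then have wo: "Well_order ?s" by (simp add: card_order_on_def)
  then interpret s: wo_rel ?s by (simp add: wo_rel_def)
  \<comment> \<open>Cantor's theorem puts the successor of \<open>\<kappa>\<close> below
    \<open>\<mu>\<close>, so a union over all stages keeps the size at most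
    \<open>\<mu>\<close>.\<close>
  have "\<kappa> <o ctwo ^c \<kappa>" using \<kappa> by (intro ordLess_ctwo_cexp) auto
  then have "?s \<le>o ctwo ^c \<kappa>"
    using \<kappa> by (intro cardSuc_least) (auto simp: Card_order_cexp)
  also have "ctwo ^c \<kappa> \<le>o \<mu> ^c \<kappa>"
    using \<kappa> \<mu> by (intro cexp_mono1 ctwo_ordLeq_Cinfinite) auto
  also note exp
  finally have s_le: "?s \<le>o \<mu>" .
  have fs: "|Field ?s| \<le>o \<mu>"
    using co_s s_le by (intro ordIso_ordLeq_trans[OF card_of_Field_ordIso])

  define step where "step C = \<Union> (F ` {A. A \<subseteq> C \<and> |A| \<le>o \<kappa>})" for C
  \<comment> \<open>One recursion clause covers zero, successor and limit stages: collect all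
    earlier stages and their one-step closures.\<close>
  define G where "G f i = (\<Union>j\<in>s.underS i. f j \<union> step (f j))" for f i
  define As where "As = s.worec G"
  have "s.adm_wo G"
    by (auto simp: s.adm_wo_def G_def)
  then have "As = G As"
    unfolding As_def by (rule s.worec_fixpoint)
  from fun_cong[OF this]
  have As: "As i = (\<Union>j\<in>s.underS i. As j \<union> step (As j))" for i
    unfolding G_def .
  have step_le: "|step C| \<le>o \<mu>" if "|C| \<le>o \<mu>" for C
    unfolding step_def using inf\<mu> \<mu>
    by (intro card_of_UNION_ordLeq_infinite_Field card_of_small_subsets[OF \<mu> _ exp that])
      (use F \<kappa> in auto)
  have As_le: "|As i| \<le>o \<mu>" for i
  proof (induction i rule: s.well_order_induct)
    case (1 i)
    have "|s.underS i| \<le>o \<mu>"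
      by (rule card_of_subset_ordLeq[OF _ fs]) (auto simp: underS_def Field_def)
    moreover have "|As j \<union> step (As j)| \<le>o \<mu>" if "j \<in> s.underS i" for j
      using that 1 step_le[of "As j"] inf\<mu> \<mu>
      by (intro card_of_Un_ordLeq_infinite_Field) (auto simp: underS_def)
    ultimately show ?case
      unfolding As[of i] using inf\<mu> \<mu> by (intro card_of_UNION_ordLeq_infinite_Field) auto
  qed
  have chain: "relChain ?s As"
    unfolding relChain_def
  proof (intro allI impI)
    fix i j assume ij: "(i, j) \<in> ?s"
    have "s.underS i \<subseteq> s.underS j"
      using ij s.TRANS s.ANTISYM unfolding underS_def trans_def antisym_def by blast
    then show "As i \<subseteq> As j"
      unfolding As[of i] As[of j] by blast
  qed
  let ?D = "\<Union>i\<in>Field ?s. As i"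
  have "|?D| \<le>o \<mu>"
    using inf\<mu> \<mu> fs As_le by (intro card_of_UNION_ordLeq_infinite_Field) auto
  moreover have "F A \<subseteq> ?D" if A: "A \<subseteq> ?D" "|A| \<le>o \<kappa>" for A
  proof -
    obtain i where i: "i \<in> Field ?s" "A \<subseteq> As i"
      using cardSuc_UNION_Cinfinite[OF \<kappa> chain A] by blast
    \<comment> \<open>An infinite cardinal order has no greatest element, so a later stage
      exists.\<close>
    obtain j where j: "j \<in> Field ?s" "i \<noteq> j" "(i, j) \<in> ?s"
      using infinite_Card_order_limit[OF co_s inf_s i(1)] by blast
    have "F A \<subseteq> step (As i)"
      unfolding step_def using i(2) A(2) by blast
    also have "\<dots> \<subseteq> As j"
      unfolding As[of j] using j by (auto simp: underS_def)
    finally show ?thesis using j(1) by blast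
  qed
  ultimately show ?thesis by blast
qed

section \<open>Disjoint families of open sets\<close>

text \<open>The bound is a cardinal on an arbitrary type, because the product of the three
  invariants lives on a product type and not on \<open>'a cardinal\<close>.\<close>

definition cellularity_le :: "'a topology \<Rightarrow> 'k rel \<Rightarrow> bool" where
  "cellularity_le X \<kappa> \<longleftrightarrow>
     (\<forall>\<U>. (\<forall>U\<in>\<U>. openin X U \<and> U \<noteq> {}) \<and> pairwise disjnt \<U> \<longrightarrow> |\<U>| \<le>o \<kappa>)"

lemma ex_maximal_disjoint_subfamily:
  "\<exists>\<W>\<subseteq>\<C>. pairwise disjnt \<W> \<and> (\<forall>C\<in>\<C>. C \<noteq> {} \<longrightarrow> (\<exists>W\<in>\<W>. \<not> disjnt C W))"
proof -
  let ?P = "{\<W>. \<W> \<subseteq> \<C> \<and> pairwise disjnt \<W>}"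
  have "\<Union>K \<in> ?P" if K: "subset.chain ?P K" for K
  proof -
    have sub: "K \<subseteq> ?P" and lin: "\<And>A B. A \<in> K \<Longrightarrow> B \<in> K \<Longrightarrow> A \<subseteq> B \<or> B \<subseteq> A"
      using K unfolding subset_chain_def by blast+
    have "disjnt U V" if UV: "U \<in> \<Union>K" "V \<in> \<Union>K" "U \<noteq> V" for U V
    proof -
      obtain A B where "A \<in> K" "B \<in> K" "U \<in> A" "V \<in> B" using UV by blast
      with lin[of A B] obtain C where "C \<in> K" "U \<in> C" "V \<in> C" by blast
      with sub UV(3) show ?thesis by (auto dest: pairwiseD)
    qed
    then show ?thesis
      using sub by (auto simp: pairwise_def)
  qed
  from subset_Zorn'[OF this] obtain \<W> where \<W>: "\<W> \<in> ?P"
    and max: "\<forall>\<W>'\<in>?P. \<W> \<subseteq> \<W>' \<longrightarrow> \<W>' = \<W>" ..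
  have "\<exists>W\<in>\<W>. \<not> disjnt C W" if C: "C \<in> \<C>" "C \<noteq> {}" for C
  proof (rule ccontr)
    assume none: "\<not> (\<exists>W\<in>\<W>. \<not> disjnt C W)"
    then have "insert C \<W> \<in> ?P"
      using \<W> C(1) by (auto simp: pairwise_insert disjnt_sym)
    with max have "insert C \<W> = \<W>" by blast
    then have "C \<in> \<W>" by blast
    with none C(2) show False by (auto simp: disjnt_def)
  qed
  with \<W> show ?thesis by blast
qed

text \<open>Take \<open>\<W>\<close> maximal disjoint among the members of \<open>\<B>\<close>
  inside \<open>U\<close>. A neighbourhood of \<open>x\<close> cut down to \<open>U\<close> contains
  a member of \<open>\<B>\<close>, which meets \<open>\<W>\<close> by maximality. Only points with a
  local pi-base inside \<open>\<B>\<close> are covered, so the lemma applies before a pi-base of the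
  whole space is available.\<close>

lemma ex_small_disjoint_closure:
  assumes "cellularity_le X \<kappa>" and \<B>: "\<And>B. B \<in> \<B> \<Longrightarrow> openin X B \<and> B \<noteq> {}" and U: "openin X U"
  shows "\<exists>\<W>\<subseteq>\<B>. |\<W>| \<le>o \<kappa> \<and> \<Union>\<W> \<subseteq> U \<and>
    (\<forall>x\<in>U. (\<exists>\<B>'\<subseteq>\<B>. local_pi_base X x \<B>') \<longrightarrow> x \<in> X closure_of \<Union>\<W>)"
proof -
  obtain \<W> where \<W>: "\<W> \<subseteq> {B \<in> \<B>. B \<subseteq> U}" "pairwise disjnt \<W>"
    and max: "\<forall>C\<in>{B \<in> \<B>. B \<subseteq> U}. C \<noteq> {} \<longrightarrow> (\<exists>W\<in>\<W>. \<not> disjnt C W)"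
    using ex_maximal_disjoint_subfamily[of "{B \<in> \<B>. B \<subseteq> U}"] by auto
  have "|\<W>| \<le>o \<kappa>"
    using assms(1) \<W> \<B> unfolding cellularity_le_def by blast
  moreover have "x \<in> X closure_of \<Union>\<W>"
    if x: "x \<in> U" "\<B>' \<subseteq> \<B>" "local_pi_base X x \<B>'" for x \<B>'
    unfolding in_closure_of
  proof (intro conjI allI impI)
    show "x \<in> topspace X" using U x(1) openin_subset by blast
    fix T assume T: "x \<in> T \<and> openin X T"
    then have "openin X (T \<inter> U)" "x \<in> T \<inter> U" using U x(1) by auto
    then obtain B where B: "B \<in> \<B>'" "B \<subseteq> T \<inter> U"
      using x(3) unfolding local_pi_base_def by blast
    with x(2) \<B> max obtain W where "W \<in> \<W>" "\<not> disjnt B W" by blast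
    with B(2) show "\<exists>y. y \<in> \<Union>\<W> \<and> y \<in> T" by (auto simp: disjnt_def)
  qed
  ultimately show ?thesis using \<W>(1) by blast
qed

section \<open>A small dense set and a small pi-base\<close>

lemma ex_small_dense_set:
  fixes X :: "'a topology" and \<kappa> :: "'k rel" and \<mu> :: "'m rel"
  assumes \<kappa>: "Cinfinite \<kappa>" and \<mu>: "Cinfinite \<mu>" and exp: "\<mu> ^c \<kappa> \<le>o \<mu>"
    and ccc: "cellularity_le X \<kappa>"
    and nq: "\<And>U. openin X U \<Longrightarrow> U \<noteq> {} \<Longrightarrow>
      \<exists>\<V>. (\<forall>V\<in>\<V>. openin X V) \<and> |\<V>| \<le>o \<kappa> \<and> topspace X \<inter> \<Inter>\<V> \<noteq> {} \<and>
           topspace X \<inter> (\<Inter>V\<in>\<V>. X closure_of V) \<subseteq> U"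
    and \<B>: "\<And>x. x \<in> topspace X \<Longrightarrow> local_pi_base X x (\<B> x) \<and> |\<B> x| \<le>o \<mu>"
  shows "\<exists>D\<subseteq>topspace X. |D| \<le>o \<mu> \<and> X closure_of D = topspace X"
proof -
  have inf\<mu>: "\<not> finite (Field \<mu>)" using \<mu> by (simp add: cinfinite_def)
  have \<kappa>\<mu>: "\<kappa> \<le>o \<mu>"
    using ordLeq_transitive[OF ordLeq_cexp2[OF ctwo_ordLeq_Cinfinite] exp] \<kappa> \<mu> by blast
  \<comment> \<open>\<open>N A\<close> holds the small families of pi-base members at points of
    \<open>A\<close>, \<open>R \<S>\<close> is what the closures of their unions leave uncovered,
    and \<open>F A\<close> picks one point of \<open>R \<S>\<close> for each small
    \<open>\<S>\<close>.\<close>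
  define N where "N A = {\<W>. \<W> \<subseteq> \<Union> (\<B> ` A) \<and> |\<W>| \<le>o \<kappa>}" for A
  define R where "R \<S> = topspace X - (\<Union>\<W>\<in>\<S>. X closure_of \<Union>\<W>)" for \<S>
  define F where
    "F A = (\<lambda>\<S>. SOME x. x \<in> R \<S>) ` {\<S>. \<S> \<subseteq> N (A \<inter> topspace X) \<and> |\<S>| \<le>o \<kappa>}" for A
  have "|F A| \<le>o \<mu>" if A: "|A| \<le>o \<kappa>" for A
  proof -
    have "|A \<inter> topspace X| \<le>o \<mu>"
      by (rule card_of_subset_ordLeq[OF Int_lower1 ordLeq_transitive[OF A \<kappa>\<mu>]])
    then have "|\<Union> (\<B> ` (A \<inter> topspace X))| \<le>o \<mu>"
      using inf\<mu> \<mu> \<B> by (intro card_of_UNION_ordLeq_infinite_Field) auto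
    then have "|N (A \<inter> topspace X)| \<le>o \<mu>"
      unfolding N_def using \<kappa> by (intro card_of_small_subsets[OF \<mu> _ exp]) auto
    then have "|{\<S>. \<S> \<subseteq> N (A \<inter> topspace X) \<and> |\<S>| \<le>o \<kappa>}| \<le>o \<mu>"
      using \<kappa> by (intro card_of_small_subsets[OF \<mu> _ exp]) auto
    then show ?thesis
      unfolding F_def by (rule card_of_image_ordLeq)
  qed
  then obtain D0 where D0: "|D0| \<le>o \<mu>"
    and closed: "\<And>A. A \<subseteq> D0 \<Longrightarrow> |A| \<le>o \<kappa> \<Longrightarrow> F A \<subseteq> D0"
    using ex_small_closed_set[OF \<kappa> \<mu> exp, of F] by blast
  \<comment> \<open>If \<open>R \<S>\<close> is empty, the choice is an arbitrary element of the
    type, possibly outside the space; such elements are discarded here.\<close>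
  define D where "D = D0 \<inter> topspace X"
  have D: "D \<subseteq> topspace X" "|D| \<le>o \<mu>"
    using card_of_subset_ordLeq[OF _ D0, of D] by (auto simp: D_def)
  have "X closure_of D = topspace X"
  proof (rule ccontr)
    assume "X closure_of D \<noteq> topspace X"
    then have "topspace X - X closure_of D \<noteq> {}"
      using closure_of_subset_topspace[of X D] by blast
    moreover have "openin X (topspace X - X closure_of D)"
      by (simp add: openin_diff)
    ultimately obtain \<V> where \<V>: "\<And>V. V \<in> \<V> \<Longrightarrow> openin X V" "|\<V>| \<le>o \<kappa>"
      and ne: "topspace X \<inter> \<Inter>\<V> \<noteq> {}"
      and sub: "topspace X \<inter> (\<Inter>V\<in>\<V>. X closure_of V) \<subseteq> topspace X - X closure_of D"
      using nq by meson
    let ?\<B> = "\<Union> (\<B> ` D)"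
    have "\<exists>\<W>\<subseteq>?\<B>. |\<W>| \<le>o \<kappa> \<and> \<Union>\<W> \<subseteq> topspace X - X closure_of V \<and>
      (\<forall>x\<in>topspace X - X closure_of V.
        (\<exists>\<B>'\<subseteq>?\<B>. local_pi_base X x \<B>') \<longrightarrow> x \<in> X closure_of \<Union>\<W>)" for V
    proof (rule ex_small_disjoint_closure[OF ccc])
      show "openin X B \<and> B \<noteq> {}" if "B \<in> ?\<B>" for B
        using that \<B> D(1) unfolding local_pi_base_def by blast
    qed (simp add: openin_diff)
    then obtain W where W: "\<And>V. W V \<subseteq> ?\<B>" "\<And>V. |W V| \<le>o \<kappa>"
      and miss: "\<And>V. \<Union> (W V) \<subseteq> topspace X - X closure_of V"
      and cover: "\<And>V x. x \<in> topspace X - X closure_of V \<Longrightarrow> \<exists>\<B>'\<subseteq>?\<B>. local_pi_base X x \<B>'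
        \<Longrightarrow> x \<in> X closure_of \<Union> (W V)"
      by metis
    define \<S> where "\<S> = W ` \<V>"
    have \<S>: "|\<S>| \<le>o \<kappa>"
      unfolding \<S>_def using \<V>(2) by (rule card_of_image_ordLeq)
    have "|\<Union>\<S>| \<le>o \<kappa>"
      unfolding \<S>_def using \<V>(2) W(2) \<kappa>
      by (intro card_of_UNION_ordLeq_infinite_Field) (auto simp: cinfinite_def)
    moreover have "\<forall>B\<in>\<Union>\<S>. \<exists>x\<in>D. B \<in> \<B> x"
      using W(1) unfolding \<S>_def by blast
    \<comment> \<open>At most \<open>\<kappa>\<close> points of \<open>D\<close> suffice to witness
      that \<open>\<S>\<close> is built from pi-base members at \<open>D\<close>.\<close>
    then obtain p where p: "\<And>B. B \<in> \<Union>\<S> \<Longrightarrow> p B \<in> D \<and> B \<in> \<B> (p B)"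
      by metis
    ultimately have A: "|p ` \<Union>\<S>| \<le>o \<kappa>" "p ` \<Union>\<S> \<subseteq> D0"
      using card_of_image_ordLeq by (blast, auto simp: D_def)
    have "\<S> \<subseteq> N (p ` \<Union>\<S> \<inter> topspace X)"
      using p W(2) D(1) unfolding N_def \<S>_def by fast
    then have "(SOME x. x \<in> R \<S>) \<in> F (p ` \<Union>\<S>)"
      unfolding F_def using \<S> by blast
    then have in_D0: "(SOME x. x \<in> R \<S>) \<in> D0"
      using closed[OF A(2,1)] by blast
    have "topspace X \<inter> \<Inter>\<V> \<subseteq> R \<S>"
    proof
      fix x assume x: "x \<in> topspace X \<inter> \<Inter>\<V>"
      have "x \<notin> X closure_of \<Union> (W V)" if V: "V \<in> \<V>" for V
      proof -
        \<comment> \<open>The open set \<open>V\<close> is disjoint from the union, hence also from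
          its closure.\<close>
        have "V \<inter> \<Union> (W V) = {}"
          using miss[of V] closure_of_subset[OF openin_subset[OF \<V>(1)[OF V]]] by blast
        then show ?thesis
          using x V \<V>(1) unfolding in_closure_of by blast
      qed
      with x show "x \<in> R \<S>" unfolding R_def \<S>_def by blast
    qed
    with ne have "R \<S> \<noteq> {}" by blast
    then have y: "(SOME x. x \<in> R \<S>) \<in> R \<S>" (is "?y \<in> _") by (simp add: some_in_eq)
    with in_D0 have "?y \<in> D" unfolding D_def R_def by blast
    then have "?y \<in> X closure_of D"
      using closure_of_subset[OF D(1)] by blast
    \<comment> \<open>The chosen point lies in \<open>D\<close>, so some
      \<open>X closure_of V\<close> omits it. Its own local pi-base is part of \<open>?\<B>\<close>,
      so \<open>W V\<close> covers it, although it was chosen uncovered.\<close>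
    with sub obtain V where V: "V \<in> \<V>" "?y \<notin> X closure_of V"
      using \<open>?y \<in> D\<close> D(1) by blast
    have "?y \<in> X closure_of \<Union> (W V)"
      using \<open>?y \<in> D\<close> D(1) V(2) \<B> by (intro cover) blast+
    with y V(1) show False unfolding R_def \<S>_def by blast
  qed
  with D show ?thesis by blast
qed

text \<open>Every neighbourhood contains a point of \<open>D\<close>, hence a pi-base member at that
  point; the local pi-bases along \<open>D\<close> thus merge into one pi-base of the space.\<close>

lemma local_pi_base_dense_Union:
  assumes D: "D \<subseteq> topspace X" "X closure_of D = topspace X"
    and \<B>: "\<And>d. d \<in> D \<Longrightarrow> local_pi_base X d (\<B> d)" and x: "x \<in> topspace X"
  shows "local_pi_base X x (\<Union> (\<B> ` D))"
  unfolding local_pi_base_def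
proof (intro conjI allI impI)
  show "\<forall>B\<in>\<Union> (\<B> ` D). openin X B \<and> B \<noteq> {}"
    using \<B> unfolding local_pi_base_def by blast
  fix U assume U: "openin X U \<and> x \<in> U"
  then obtain d where d: "d \<in> D" "d \<in> U"
    using x D(2) in_closure_of[of x X D] by blast
  then obtain B where "B \<in> \<B> d" "B \<subseteq> U"
    using U \<B>[OF d(1)] unfolding local_pi_base_def by blast
  with d(1) show "\<exists>B\<in>\<Union> (\<B> ` D). B \<subseteq> U"
    by blast
qed

section \<open>Counting closures of open sets, then points\<close>

lemma card_of_closures_of_open_sets:
  assumes \<kappa>: "Card_order \<kappa>" and \<mu>: "Cinfinite \<mu>" and exp: "\<mu> ^c \<kappa> \<le>o \<mu>"
    and ccc: "cellularity_le X \<kappa>"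
    and \<B>: "\<And>x. x \<in> topspace X \<Longrightarrow> local_pi_base X x \<B>" "|\<B>| \<le>o \<mu>"
  shows "|{X closure_of U | U. openin X U}| \<le>o \<mu>"
proof -
  have "X closure_of U \<in> (\<lambda>\<W>. X closure_of \<Union>\<W>) ` {\<W>. \<W> \<subseteq> \<B> \<and> |\<W>| \<le>o \<kappa>}"
    if U: "openin X U" for U
  proof (cases "U = {}")
    \<comment> \<open>In an empty space nothing is known about the members of \<open>\<B>\<close>,
      so the empty set is handled by the empty subfamily. A nonempty \<open>U\<close> supplies a
      point at which \<open>\<B>\<close> is a local pi-base.\<close>
    case True
    have "|{}| \<le>o \<kappa>"
      using \<kappa> by (rule Card_order_empty)
    then show ?thesis
      using True by (intro image_eqI[of _ _ "{}"]) auto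
  next
    case False
    then have "openin X B \<and> B \<noteq> {}" if "B \<in> \<B>" for B
      using that U openin_subset \<B>(1) unfolding local_pi_base_def by blast
    then obtain \<W> where \<W>: "\<W> \<subseteq> \<B>" "|\<W>| \<le>o \<kappa>" "\<Union>\<W> \<subseteq> U"
      and cl: "\<forall>x\<in>U. (\<exists>\<B>'\<subseteq>\<B>. local_pi_base X x \<B>') \<longrightarrow> x \<in> X closure_of \<Union>\<W>"
      using ex_small_disjoint_closure[OF ccc _ U] by meson
    have "U \<subseteq> X closure_of \<Union>\<W>"
      using cl \<B>(1) U openin_subset by blast
    then have "X closure_of U = X closure_of \<Union>\<W>"
      using closure_of_mono[OF \<W>(3)] closure_of_mono[of U "X closure_of \<Union>\<W>" X] by auto
    with \<W> show ?thesis by blast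
  qed
  then have "|{X closure_of U | U. openin X U}| \<le>o |{\<W>. \<W> \<subseteq> \<B> \<and> |\<W>| \<le>o \<kappa>}|"
    by (intro surj_imp_ordLeq[of _ "\<lambda>\<W>. X closure_of \<Union>\<W>"]) blast
  then show ?thesis
    using card_of_small_subsets[OF \<mu> \<kappa> exp \<B>(2)] by (rule ordLeq_transitive)
qed

lemma card_of_topspace_le_weak_closed_pseudobase:
  assumes \<kappa>: "Card_order \<kappa>" and \<mu>: "Cinfinite \<mu>" and exp: "\<mu> ^c \<kappa> \<le>o \<mu>"
    and cls: "|{X closure_of U | U. openin X U}| \<le>o \<mu>"
    and wp: "\<And>x. x \<in> topspace X \<Longrightarrow> \<exists>\<V>. weak_closed_pseudobase X x \<V> \<and> |\<V>| \<le>o \<kappa>"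
  shows "|topspace X| \<le>o \<mu>"
proof -
  let ?C = "{X closure_of U | U. openin X U}"
  \<comment> \<open>Recovers a point from the family of closures that has it as its only common
    point.\<close>
  let ?f = "\<lambda>\<S>. the_elem (topspace X \<inter> \<Inter>\<S>)"
  have "x \<in> ?f ` {\<S>. \<S> \<subseteq> ?C \<and> |\<S>| \<le>o \<kappa>}" if x: "x \<in> topspace X" for x
  proof -
    obtain \<V> where \<V>: "weak_closed_pseudobase X x \<V>" "|\<V>| \<le>o \<kappa>"
      using wp[OF x] by blast
    let ?\<S> = "(closure_of) X ` \<V>"
    have "|?\<S>| \<le>o \<kappa>" using \<V>(2) by (rule card_of_image_ordLeq)
    moreover have "?\<S> \<subseteq> ?C" "{x} = topspace X \<inter> \<Inter>?\<S>"
      using \<V>(1) unfolding weak_closed_pseudobase_def by auto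
    then have "?\<S> \<subseteq> ?C" "x = ?f ?\<S>" by (auto, metis the_elem_eq)
    ultimately show ?thesis by blast
  qed
  then have "|topspace X| \<le>o |{\<S>. \<S> \<subseteq> ?C \<and> |\<S>| \<le>o \<kappa>}|"
    by (intro surj_imp_ordLeq[of _ ?f]) blast
  then show ?thesis
    using card_of_small_subsets[OF \<mu> \<kappa> exp cls] by (rule ordLeq_transitive)
qed

theorem corollary2p10:
  fixes X :: "'a topology"
  assumes "Hausdorff_space X"
  shows "|topspace X| \<le>o
    pi_character X ^c
      (cellularity X *c nonquasiregularity_degree X *c weak_closed_pseudocharacter X)"
proof -
  let ?c = "cellularity X" and ?n = "nonquasiregularity_degree X"
    and ?w = "weak_closed_pseudocharacter X" and ?p = "pi_character X"
  let ?\<kappa> = "?c *c ?n *c ?w"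
  let ?\<mu> = "?p ^c ?\<kappa>"
  note specs = cellularity_spec[of X] pi_character_spec[of X]
    nonquasiregularity_degree_spec[OF assms] weak_closed_pseudocharacter_spec[OF assms]
  have ci: "Cinfinite ?c" "Cinfinite ?p" "Cinfinite ?n" "Cinfinite ?w"
    using specs by (simp_all add: is_least_infinite_card_def)
  have nw: "Cinfinite (?n *c ?w)"
    by (intro Cinfinite_cprod2 Cinfinite_Cnotzero ci)
  then have \<kappa>: "Cinfinite ?\<kappa>"
    by (rule Cinfinite_cprod2[OF Cinfinite_Cnotzero[OF ci(1)]])
  \<comment> \<open>Each factor lies below the product because the others are nonzero, so
    \<open>?\<kappa>\<close> bounds all three invariants.\<close>
  have nw_le: "?n *c ?w \<le>o ?\<kappa>"
    using nw by (intro ordLeq_cprod2 Cinfinite_Cnotzero ci(1)) auto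
  have c_le: "?c \<le>o ?\<kappa>"
    using ordLeq_ordIso_trans[OF ordLeq_cprod2[of "?n *c ?w" ?c] cprod_com] ci(1)
      Cinfinite_Cnotzero[OF nw] by blast
  have "?n \<le>o ?n *c ?w"
    using ordLeq_ordIso_trans[OF ordLeq_cprod2[of ?w ?n] cprod_com] ci(3)
      Cinfinite_Cnotzero[OF ci(4)] by blast
  then have n_le: "?n \<le>o ?\<kappa>" using nw_le by (rule ordLeq_transitive)
  have "?w \<le>o ?n *c ?w"
    using ci(4) by (intro ordLeq_cprod2 Cinfinite_Cnotzero ci(3)) auto
  then have w_le: "?w \<le>o ?\<kappa>" using nw_le by (rule ordLeq_transitive)
  have \<mu>: "Cinfinite ?\<mu>"
    by (intro Cinfinite_cexp ctwo_ordLeq_Cinfinite ci(2) \<kappa>)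
  \<comment> \<open>Since \<open>?\<kappa>\<close> is infinite, raising to the power
    \<open>?\<kappa>\<close> twice gives the exponent \<open>?\<kappa>\<close> times itself, which
    is again \<open>?\<kappa>\<close>.\<close>
  have exp: "?\<mu> ^c ?\<kappa> \<le>o ?\<mu>"
    using \<kappa> ci(2)
    by (intro ordIso_imp_ordLeq cexp_cprod_ordLeq Cinfinite_Cnotzero ordLeq_refl) auto
  have ccc: "cellularity_le X ?\<kappa>"
    using specs(1) ordLeq_transitive[OF _ c_le] unfolding is_least_infinite_card_def cellularity_le_def
    by blast
  have p_le: "?p \<le>o ?\<mu>"
    using ci(2) by (intro ordLeq_cexp1 Cinfinite_Cnotzero \<kappa>) auto
  have "\<forall>x\<in>topspace X. \<exists>\<B>. local_pi_base X x \<B> \<and> |\<B>| \<le>o ?\<mu>"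
    using specs(2) ordLeq_transitive[OF _ p_le] unfolding is_least_infinite_card_def by blast
  then obtain \<B> where \<B>: "\<And>x. x \<in> topspace X \<Longrightarrow> local_pi_base X x (\<B> x) \<and> |\<B> x| \<le>o ?\<mu>"
    by metis
  have nq: "\<exists>\<V>. (\<forall>V\<in>\<V>. openin X V) \<and> |\<V>| \<le>o ?\<kappa> \<and> topspace X \<inter> \<Inter>\<V> \<noteq> {} \<and>
      topspace X \<inter> (\<Inter>V\<in>\<V>. X closure_of V) \<subseteq> U" if U: "openin X U" "U \<noteq> {}" for U
  proof -
    obtain \<V> where "\<forall>V\<in>\<V>. openin X V" "|\<V>| \<le>o ?n" "topspace X \<inter> \<Inter>\<V> \<noteq> {}"
      "topspace X \<inter> (\<Inter>V\<in>\<V>. X closure_of V) \<subseteq> U"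
      using specs(3) U unfolding is_least_infinite_card_def by meson
    then show ?thesis using ordLeq_transitive[OF _ n_le] by blast
  qed
  obtain D where D: "D \<subseteq> topspace X" "|D| \<le>o ?\<mu>" "X closure_of D = topspace X"
    using ex_small_dense_set[OF \<kappa> \<mu> exp ccc nq \<B>] by blast
  have "|\<Union> (\<B> ` D)| \<le>o ?\<mu>"
    using D(1,2) \<B> \<mu>
    by (intro card_of_UNION_ordLeq_infinite_Field) (auto simp: cinfinite_def)
  moreover have "local_pi_base X x (\<Union> (\<B> ` D))" if "x \<in> topspace X" for x
    using local_pi_base_dense_Union[OF D(1,3) _ that] \<B> D(1) by blast
  ultimately have cls: "|{X closure_of U | U. openin X U}| \<le>o ?\<mu>"
    using \<kappa> by (intro card_of_closures_of_open_sets[OF _ \<mu> exp ccc]) auto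
  have wp: "\<exists>\<V>. weak_closed_pseudobase X x \<V> \<and> |\<V>| \<le>o ?\<kappa>" if x: "x \<in> topspace X" for x
  proof -
    obtain \<V> where \<V>: "weak_closed_pseudobase X x \<V>"
      "|\<V>| \<le>o weak_closed_pseudocharacter_at X x"
      using weak_closed_pseudocharacter_at_spec[OF assms x]
      unfolding is_least_infinite_card_def by blast
    have "weak_closed_pseudocharacter_at X x \<le>o ?w"
      using specs(4) x unfolding is_least_infinite_card_def by blast
    from ordLeq_transitive[OF \<V>(2) ordLeq_transitive[OF this w_le]] \<V>(1)
    show ?thesis by blast
  qed
  show ?thesis
    using \<kappa> by (intro card_of_topspace_le_weak_closed_pseudobase[OF _ \<mu> exp cls wp]) auto
qed

end
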